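(* Let $d=2$, let $0<u_1,u_2<c$, and let $W=w(u_2\boldsymbol e_2)\,w(u_1\boldsymbol e_1)$ (two perpendicular subsonic steps). Put $\gamma_1=(1-u_1^2/c^2)^{-1/2}$ and $\chi=\gamma_1u_1u_2$. Then the endpoint cometric $Q_{\mathrm{end}}=W^{-1}Q_*W^{-\mathrm T}$ satisfies $(Q_{\mathrm{end}})_{00}=1$ and $$Q_{\mathrm{end}}=\begin{pmatrix}1&\boldsymbol v_3^{\mathrm T}\\ \boldsymbol v_3&\boldsymbol v_3\boldsymbol v_3^{\mathrm T}-C_3\end{pmatrix},\qquad \boldsymbol v_3=\begin{pmatrix}u_1\\ \gamma_1u_2\end{pmatrix},\qquad C_3=\begin{pmatrix}c^2&\chi\\ \chi&c^2+\chi^2/c^2\end{pmatrix}.$$ Moreover $\det C_3=c^4$, and $$A_3:=C_3-\boldsymbol v_3\boldsymbol v_3^{\mathrm T}=\operatorname{diag}(c^2-u_1^2,\;c^2-u_2^2)\succ0 .$$ Since $C_3\neq c^2I$, the matrix $Q_{\mathrm{end}}$ is not of the form $Q_c(\boldsymbol v)$ for any $\boldsymbol v$; that is, the family $\{Q_c(\boldsymbol v)\}$ is not closed under canonical transport. The same conclusion holds for collinear steps: if instead $W=w(u_2\boldsymbol e_1)\,w(u_1\boldsymbol e_1)$ with $0<u_1,u_2<c$, then $q_{00}:=(Q_{\mathrm{end}})_{00}\neq1$, and, when $q_{00}>0$, the normalised endpoint $Q_{\mathrm{end}}/q_{00}$, written as $\begin{pmatrix}1&\boldsymbol v^{\mathrm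 T}\\ \boldsymbol v&\boldsymbol v\boldsymbol v^{\mathrm T}-C\end{pmatrix}$, has an anisotropic tensor $C$ (not a multiple of the identity), so it is not of the form $Q_c(\boldsymbol v')$ for any $\boldsymbol v'$.
   Context: Fix $c>0$. Coordinates on $\mathbb R^{1+d}$ are $\xi=(t,\boldsymbol x)$; the index $0$ refers to $t$. Let $\boldsymbol e_1,\boldsymbol e_2$ be the standard basis of $\mathbb R^2$. For $\boldsymbol v\in\mathbb R^d$, $|\boldsymbol v|<c$, let $\gamma=(1-|\boldsymbol v|^2/c^2)^{-1/2}$, $\hat{\boldsymbol v}=\boldsymbol v/|\boldsymbol v|$ (terms containing $\hat{\boldsymbol v}$ are read as $0$ if $\boldsymbol v=0$), and define the linear maps (identified with their matrices) $g(\boldsymbol v):(t,\boldsymbol x)\mapsto(t,\boldsymbol x-\boldsymbol vt)$ and $\ell(\boldsymbol v):(t,\boldsymbol x)\mapsto\bigl(\gamma(t-\boldsymbol v\cdot\boldsymbol x/c^2),\ \boldsymbol x+(\gamma-1)(\hat{\boldsymbol v}\cdot\boldsymbol x)\hat{\boldsymbol v}-\gamma\boldsymbol vt\bigr)$, and $w(\boldsymbol v)=\ell(-\boldsymbol v)\,g(\boldsymbol v)$. Cometrics: $Q_c(\boldsymbol v)=\begin{pmatrix}1&\boldsymbol v^{\mathrm T}\\ \boldsymbol v&\boldsymbol v\boldsymbol v^{\mathrm T}-c^2I\end{pmatrix}$ and $Q_*=\begin{pmatrix}1&0\\0&-c^2I\end{pmatrix}$. For increments $\boldsymbol v_1,\dots,\boldsymbol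 v_n$ the canonical transport is the composite $W=w(\boldsymbol v_n)\cdots w(\boldsymbol v_1)$, and its endpoint cometric is $Q_{\mathrm{end}}=W^{-1}Q_*W^{-\mathrm T}$. Cometrics are identified up to positive scalar factors. *)

theory Defs
  imports "HOL-Analysis.Analysis"
begin

text \<open>
  Space-time of dimension \<open>1 + d\<close> is \<^typ>\<open>real ^ ('d::finite) option\<close> with \<open>d = CARD('d)\<close>:
  the index \<^term>\<open>None\<close> is the time index (written 0 on paper) and the indices
  \<^term>\<open>Some k\<close> are the spatial ones.
\<close>

definition event :: "real \<Rightarrow> real ^ 'd \<Rightarrow> real ^ 'd option" where
  "event t x = (\<chi> i. case i of None \<Rightarrow> t | Some k \<Rightarrow> x $ k)"

definition time_part :: "real ^ ('d::finite) option \<Rightarrow> real" where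
  "time_part \<xi> = \<xi> $ None"

definition space_part :: "real ^ 'd option \<Rightarrow> real ^ 'd" where
  "space_part \<xi> = (\<chi> k. \<xi> $ Some k)"

definition block :: "real \<Rightarrow> real ^ 'd \<Rightarrow> real ^ 'd ^ 'd \<Rightarrow> real ^ 'd option ^ 'd option" where
  "block a b D = (\<chi> i j. case i of
      None \<Rightarrow> (case j of None \<Rightarrow> a | Some l \<Rightarrow> b $ l)
    | Some k \<Rightarrow> (case j of None \<Rightarrow> b $ k | Some l \<Rightarrow> D $ k $ l))"

definition outer :: "real ^ 'd \<Rightarrow> real ^ 'd ^ 'd" where
  "outer v = (\<chi> k l. v $ k * v $ l)"

definition positive_definite :: "real ^ 'd ^ 'd \<Rightarrow> bool" where
  "positive_definite A \<longleftrightarrow> transpose A = A \<and> (\<forall>x. x \<noteq> 0 \<longrightarrow> x \<bullet> (A *v x) > 0)"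

definition lorentz_factor :: "real \<Rightarrow> real ^ 'd \<Rightarrow> real" where
  "lorentz_factor c v = 1 / sqrt (1 - (norm v)\<^sup>2 / c\<^sup>2)"

definition galilei :: "real ^ 'd \<Rightarrow> real ^ 'd option \<Rightarrow> real ^ 'd option" where
  "galilei v \<xi> = event (time_part \<xi>) (space_part \<xi> - time_part \<xi> *\<^sub>R v)"

text \<open>
  For \<open>v = 0\<close> the unit vector \<open>v /\<^sub>R norm v\<close> is \<open>0\<close>, so the terms that contain it vanish.
\<close>

definition lorentz :: "real \<Rightarrow> real ^ 'd \<Rightarrow> real ^ 'd option \<Rightarrow> real ^ 'd option" where
  "lorentz c v \<xi> =
    (let \<gamma> = lorentz_factor c v; n = v /\<^sub>R norm v; t = time_part \<xi>; x = space_part \<xi>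
     in event (\<gamma> * (t - (v \<bullet> x) / c\<^sup>2))
              (x + ((\<gamma> - 1) * (n \<bullet> x)) *\<^sub>R n - (\<gamma> * t) *\<^sub>R v))"

definition canonical_step :: "real \<Rightarrow> real ^ 'd \<Rightarrow> real ^ 'd option ^ 'd option" where
  "canonical_step c v = matrix (lorentz c (- v)) ** matrix (galilei v)"

text \<open>The increments are listed in the order in which they are applied, earliest first.\<close>

definition canonical_transport :: "real \<Rightarrow> (real ^ 'd) list \<Rightarrow> real ^ 'd option ^ 'd option" where
  "canonical_transport c vs = fold (\<lambda>v W. canonical_step c v ** W) vs (mat 1)"

definition Q_c :: "real \<Rightarrow> real ^ 'd \<Rightarrow> real ^ 'd option ^ 'd option" where
  "Q_c c v = block 1 v (outer v - c\<^sup>2 *\<^sub>R mat 1)"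

definition Q_star :: "real \<Rightarrow> real ^ ('d::finite) option ^ 'd option" where
  "Q_star c = block 1 0 (- (c\<^sup>2 *\<^sub>R mat 1))"

definition endpoint_cometric ::
    "real \<Rightarrow> real ^ ('d::finite) option ^ 'd option \<Rightarrow> real ^ 'd option ^ 'd option" where
  "endpoint_cometric c W = matrix_inv W ** Q_star c ** transpose (matrix_inv W)"

definition same_cometric ::
    "real ^ ('d::finite) option ^ 'd option \<Rightarrow> real ^ 'd option ^ 'd option \<Rightarrow> bool" where
  "same_cometric P Q \<longleftrightarrow> (\<exists>k>0. P = k *\<^sub>R Q)"

definition closed_under_canonical_transport ::
    "real \<Rightarrow> (real ^ ('d::finite) option ^ 'd option) set \<Rightarrow> bool" where
  "closed_under_canonical_transport c F \<longleftrightarrow>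
    (\<forall>vs. (\<forall>v\<in>set vs. norm v < c) \<longrightarrow>
      (\<exists>Q\<in>F. same_cometric (endpoint_cometric c (canonical_transport c vs)) Q))"

text \<open>
  The operators \<^const>\<open>matrix\<close> and \<^const>\<open>matrix_inv\<close> are meaningful only for linear maps and
  invertible matrices, respectively.  The following facts show that they are used only in this way.
\<close>

lemma time_event [simp]: "time_part (event t x) = t"
  by (simp add: time_part_def event_def)

lemma space_event [simp]: "space_part (event t x) = x"
  by (simp add: space_part_def event_def vec_eq_iff)

lemma event_time_space [simp]: "event (time_part \<xi>) (space_part \<xi>) = \<xi>"
  by (simp add: time_part_def space_part_def event_def vec_eq_iff split: option.split)

lemma linear_galilei: "linear (galilei v)"
  by (rule linearI)
    (auto simp: galilei_def event_def time_part_def space_part_def vec_eq_iff algebra_simps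
      split: option.split)

lemma linear_lorentz: "linear (lorentz c v)"
proof -
  have sp: "space_part (x + y) = space_part x + space_part y" "space_part (r *\<^sub>R x) = r *\<^sub>R space_part x"
    "time_part (x + y) = time_part x + time_part y" "time_part (r *\<^sub>R x) = r * time_part x"
    for x y :: "real ^ 'a option" and r
    by (auto simp: space_part_def time_part_def vec_eq_iff)
  have ev: "event (s + t) (x + y) = event s x + event t y"
    "event (r * t) (r *\<^sub>R x) = r *\<^sub>R event t x" for s t r and x y :: "real ^ 'a"
    by (auto simp: event_def vec_eq_iff split: option.split)
  show ?thesis
    by (rule linearI)
      (simp_all add: lorentz_def Let_def sp inner_add_right ev[symmetric] algebra_simps
        add_divide_distrib)
qed

lemma galilei_inverse: "galilei (- v) (galilei v \<xi>) = \<xi>"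
  by (simp add: galilei_def)

lemma lorentz_inverse:
  fixes v :: "real ^ 'd"
  assumes "norm v < c"
  shows "lorentz c v (lorentz c (- v) \<xi>) = \<xi>"
proof (cases "v = 0")
  case True
  then show ?thesis by (simp add: lorentz_def lorentz_factor_def)
next
  case False
  define u n t x s g where "u = norm v" and "n = v /\<^sub>R norm v" and "t = time_part \<xi>"
    and "x = space_part \<xi>" and "s = n \<bullet> x" and "g = lorentz_factor c v"
  have c: "c > 0" and u: "u > 0" "u < c"
    using assms False unfolding u_def by (auto intro: le_less_trans[OF norm_ge_zero])
  have v: "v = u *\<^sub>R n" and nn: "n \<bullet> n = 1"
    using False by (auto simp: u_def n_def dot_square_norm power2_eq_square)
  have "u\<^sup>2 < c\<^sup>2"
    using u by (simp add: power_strict_mono)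
  hence "1 - u\<^sup>2 / c\<^sup>2 > 0"
    using c by simp
  hence g: "g\<^sup>2 * (1 - u\<^sup>2 / c\<^sup>2) = 1"
    unfolding g_def lorentz_factor_def u_def[symmetric]
    by (metis less_imp_le less_irrefl nonzero_eq_divide_eq one_power2 power_divide
        real_sqrt_pow2)
  have n': "(- v) /\<^sub>R norm v = - n" and g': "lorentz_factor c (- v) = g"
    by (simp_all add: n_def g_def lorentz_factor_def)
  define t' where "t' = g * (t + u * s / c\<^sup>2)"
  define x' where "x' = x + ((g - 1) * s + g * u * t) *\<^sub>R n"
  have step: "lorentz c (- v) \<xi> = event t' x'"
    unfolding lorentz_def Let_def norm_minus_cancel n' g' t_def[symmetric] x_def[symmetric]
    by (simp add: v s_def[symmetric] t'_def x'_def algebra_simps)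
  have s': "n \<bullet> x' = g * s + g * u * t"
    by (simp add: x'_def inner_add_right nn s_def[symmetric] algebra_simps)
  have "g * (t' - u * (n \<bullet> x') / c\<^sup>2) = (g\<^sup>2 * (1 - u\<^sup>2 / c\<^sup>2)) * t"
    using c by (simp add: s' t'_def field_simps power2_eq_square)
  hence time: "g * (t' - (v \<bullet> x') / c\<^sup>2) = t"
    by (simp add: v g)
  have "(g - 1) * s + g * u * t + (g - 1) * (n \<bullet> x') - g * t' * u
      = (g\<^sup>2 * (1 - u\<^sup>2 / c\<^sup>2) - 1) * s"
    using c by (simp add: s' t'_def field_simps power2_eq_square)
  hence "(g - 1) * s + g * u * t + (g - 1) * (n \<bullet> x') - g * t' * u = 0"
    by (simp add: g)
  moreover have "x' + ((g - 1) * (n \<bullet> x')) *\<^sub>R n - (g * t') *\<^sub>R v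
      = x + ((g - 1) * s + g * u * t + (g - 1) * (n \<bullet> x') - g * t' * u) *\<^sub>R n"
    by (simp add: x'_def v scaleR_add_left scaleR_diff_left)
  ultimately have space: "x' + ((g - 1) * (n \<bullet> x')) *\<^sub>R n - (g * t') *\<^sub>R v = x"
    by simp
  have "lorentz c v (event t' x') = event t x"
    unfolding lorentz_def Let_def n_def[symmetric] g_def[symmetric] time_event space_event
      time space ..
  then show ?thesis
    by (simp add: step t_def x_def)
qed

lemma invertible_canonical_step:
  fixes v :: "real ^ 'd"
  assumes "norm v < c"
  shows "invertible (canonical_step c v)"
proof -
  have inv: "invertible (matrix f)"
    if "linear f" "linear h" "\<And>\<xi>. h (f \<xi>) = \<xi>" for f h :: "real ^ 'd option \<Rightarrow> real ^ 'd option"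
  proof -
    have "matrix h ** matrix f = matrix (h \<circ> f)"
      using that by (simp add: matrix_compose)
    also have "h \<circ> f = id"
      using that by auto
    finally show ?thesis
      by (metis invertible_left_inverse matrix_id_mat_1)
  qed
  show ?thesis
    unfolding canonical_step_def
    using inv[OF linear_lorentz linear_lorentz lorentz_inverse[OF assms]]
      inv[OF linear_galilei linear_galilei galilei_inverse[of v]]
    by (rule invertible_mult)
qed

end

theory Submission
  imports Defs
begin

text \<open>
  Each step satisfies \<open>w(v)\<^sup>-\<^sup>1 Q\<^sub>* w(v)\<^sup>-\<^sup>T = Q\<^sub>c(v)\<close>.  So a second step has the effect of congruence
  of \<open>Q\<^sub>c(v\<^sub>2)\<close> by \<open>w(v\<^sub>1)\<^sup>-\<^sup>1\<close>, and along a coordinate axis this inverse is the triangular map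
  \<open>(t, x) \<mapsto> (\<gamma>(t - u x / c\<^sup>2), x / \<gamma>)\<close>, of determinant 1.

  For perpendicular steps the spatial block of the result is diagonal, so subtracting it from
  \<open>v\<^sub>3 v\<^sub>3\<^sup>T\<close> leaves the off-diagonal entry \<open>\<chi>\<close>.  For collinear steps the determinant of the
  \<open>(t, x)\<close> block stays \<open>- c\<^sup>2\<close>, so the normalised tensor is \<open>diag(c\<^sup>2/q\<^sup>2, c\<^sup>2/q)\<close>, which is isotropic
  only if \<open>q = 1\<close>; but \<open>q - 1\<close> has the sign of \<open>u\<^sub>1 u\<^sub>2 (u\<^sub>1 u\<^sub>2 - 2 c\<^sup>2) < 0\<close>.
\<close>

section \<open>Matrix inverses and congruence of cometrics\<close>

lemma matrix_inv_unique:
  fixes A B :: "'a::semiring_1 ^ 'n ^ 'n"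
  assumes "A ** B = mat 1" "B ** A = mat 1"
  shows "matrix_inv A = B"
proof -
  \<comment> \<open>\<open>matrix_inv\<close> is a Hilbert choice; \<open>B\<close> witnesses that
    the chosen matrix satisfies both equations.\<close>
  have "A ** matrix_inv A = mat 1 \<and> matrix_inv A ** A = mat 1"
    unfolding matrix_inv_def by (rule someI[of _ B]) (simp add: assms)
  then show ?thesis
    by (metis assms(2) matrix_mul_assoc matrix_mul_lid matrix_mul_rid)
qed

lemma matrix_inv_right: "invertible A \<Longrightarrow> A ** matrix_inv A = mat 1"
  and matrix_inv_left: "invertible A \<Longrightarrow> matrix_inv A ** A = mat 1"
  for A :: "'a::semiring_1 ^ 'n ^ 'n"
  unfolding invertible_def by (auto simp: matrix_inv_unique)

lemma matrix_inv_mult: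
  fixes A B :: "'a::field ^ 'n ^ 'n"
  assumes "invertible A" "invertible B"
  shows "matrix_inv (A ** B) = matrix_inv B ** matrix_inv A"
proof (rule matrix_inv_unique)
  have "A ** B ** (matrix_inv B ** matrix_inv A) = A ** (B ** matrix_inv B) ** matrix_inv A"
    by (simp only: matrix_mul_assoc)
  then show "A ** B ** (matrix_inv B ** matrix_inv A) = mat 1"
    using assms by (simp add: matrix_inv_right)
  have "matrix_inv B ** matrix_inv A ** (A ** B) = matrix_inv B ** (matrix_inv A ** A) ** B"
    by (simp only: matrix_mul_assoc)
  then show "matrix_inv B ** matrix_inv A ** (A ** B) = mat 1"
    using assms by (simp add: matrix_inv_left)
qed

text \<open>Inversion reverses the product, so the earlier factor \<open>W\<close> ends up
  outermost. This allows the last step to be evaluated first, by itself.\<close>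

lemma endpoint_cometric_mult:
  assumes "invertible V" "invertible W"
  shows "endpoint_cometric c (V ** W) =
    matrix_inv W ** endpoint_cometric c V ** transpose (matrix_inv W)"
  using assms
  by (simp add: endpoint_cometric_def matrix_inv_mult matrix_transpose_mul matrix_mul_assoc)

text \<open>The inner pair \<open>lorentz c v\<close>, \<open>lorentz c (- v)\<close> cancels first,
  then the Galilean pair. Keeping the inverse as the matrix of a map lets its columns be read off
  from basis events.\<close>

lemma matrix_inv_canonical_step:
  fixes v :: "real ^ 'd"
  assumes "norm v < c"
  shows "matrix_inv (canonical_step c v) = matrix (\<lambda>\<xi>. galilei (- v) (lorentz c v \<xi>))"
proof (rule matrix_inv_unique)
  have "matrix (galilei (- v)) ** (matrix (lorentz c v) ** matrix (lorentz c (- v))) **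
      matrix (galilei v)
    = matrix (galilei (- v) \<circ> (lorentz c v \<circ> lorentz c (- v)) \<circ> galilei v)"
    by (simp add: matrix_compose linear_compose linear_galilei linear_lorentz)
  also have "galilei (- v) \<circ> (lorentz c v \<circ> lorentz c (- v)) \<circ> galilei v = id"
    using lorentz_inverse[OF assms] galilei_inverse[of v] by auto
  finally show "matrix (\<lambda>\<xi>. galilei (- v) (lorentz c v \<xi>)) ** canonical_step c v = mat 1"
    by (simp add: canonical_step_def matrix_mul_assoc matrix_id_mat_1[unfolded id_def]
        matrix_compose[OF linear_lorentz linear_galilei, unfolded o_def])
  then show "canonical_step c v ** matrix (\<lambda>\<xi>. galilei (- v) (lorentz c v \<xi>)) = mat 1"
    by (simp add: matrix_left_right_inverse)
qed

section \<open>The Lorentz factor and single steps along a coordinate axis\<close>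

lemma
  assumes "norm v < c"
  shows lorentz_factor_pos: "lorentz_factor c v > 0"
    and lorentz_factor_square: "(lorentz_factor c v)\<^sup>2 * (c\<^sup>2 - (norm v)\<^sup>2) = c\<^sup>2"
proof -
  have c: "c > 0"
    using assms by (rule le_less_trans[OF norm_ge_zero])
  have "(norm v)\<^sup>2 < c\<^sup>2"
    using assms by (simp add: power_strict_mono)
  then have pos: "1 - (norm v)\<^sup>2 / c\<^sup>2 > 0"
    using c by simp
  then show "lorentz_factor c v > 0"
    by (simp add: lorentz_factor_def)
  have "(lorentz_factor c v)\<^sup>2 = 1 / (1 - (norm v)\<^sup>2 / c\<^sup>2)"
    using pos by (simp add: lorentz_factor_def power_divide)
  also have "\<dots> = c\<^sup>2 / (c\<^sup>2 - (norm v)\<^sup>2)"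
    using c by (simp add: field_simps)
  finally show "(lorentz_factor c v)\<^sup>2 * (c\<^sup>2 - (norm v)\<^sup>2) = c\<^sup>2"
    using \<open>(norm v)\<^sup>2 < c\<^sup>2\<close> by simp
qed

text \<open>With \<gamma> as a separate parameter the entries are rational functions; the relation
  between \<gamma> and \<open>u\<close> is brought in only by the lemmas.\<close>

definition inverse_axis_step ::
    "real \<Rightarrow> real \<Rightarrow> real \<Rightarrow> 'd \<Rightarrow> real ^ ('d::finite) option ^ 'd option" where
  "inverse_axis_step c \<gamma> u k = (\<chi> i j. case i of
      None \<Rightarrow> (case j of None \<Rightarrow> \<gamma> | Some l \<Rightarrow> if l = k then - \<gamma> * u / c\<^sup>2 else 0)
    | Some m \<Rightarrow> (case j of None \<Rightarrow> 0
        | Some l \<Rightarrow> if l = m then if m = k then 1 / \<gamma> else 1 else 0))"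

lemma matrix_inv_canonical_step_axis:
  fixes k :: "'d::finite" and u c :: real
  assumes u: "0 < u" "u < c"
  defines "\<gamma> \<equiv> lorentz_factor c (u *\<^sub>R axis k 1)"
  shows "matrix_inv (canonical_step c (u *\<^sub>R axis k 1)) = inverse_axis_step c \<gamma> u k"
proof -
  have n: "norm (u *\<^sub>R axis k 1 :: real ^ 'd) = u"
    using u by simp
  have \<gamma>: "\<gamma> > 0" "\<gamma>\<^sup>2 * (c\<^sup>2 - u\<^sup>2) = c\<^sup>2"
    using lorentz_factor_pos[of "u *\<^sub>R axis k 1 :: real ^ 'd" c]
      lorentz_factor_square[of "u *\<^sub>R axis k 1 :: real ^ 'd" c] u n
    by (simp_all add: \<gamma>_def)
  have triangular: "galilei (- (u *\<^sub>R axis k 1)) (lorentz c (u *\<^sub>R axis k 1) (event t x)) =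
      event (\<gamma> * (t - u * x $ k / c\<^sup>2)) (x + ((1 / \<gamma> - 1) * x $ k) *\<^sub>R axis k 1)"
    for t and x :: "real ^ 'd"
  proof -
    have unit: "(u *\<^sub>R axis k 1) /\<^sub>R u = (axis k 1 :: real ^ 'd)"
      using u by simp
    define t' where "t' = \<gamma> * (t - u * x $ k / c\<^sup>2)"
    have "lorentz c (u *\<^sub>R axis k 1) (event t x) =
        event t' (x + ((\<gamma> - 1) * x $ k) *\<^sub>R axis k 1 - (\<gamma> * t) *\<^sub>R u *\<^sub>R axis k 1)"
      unfolding lorentz_def Let_def n unit \<gamma>_def[symmetric] t'_def
      by (simp add: inner_axis')
    then have "galilei (- (u *\<^sub>R axis k 1)) (lorentz c (u *\<^sub>R axis k 1) (event t x)) =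
        event t' (x + ((\<gamma> - 1) * x $ k - \<gamma> * t * u + t' * u) *\<^sub>R axis k 1)"
      by (simp add: galilei_def scaleR_add_left scaleR_diff_left algebra_simps)
    also have "(\<gamma> - 1) * x $ k - \<gamma> * t * u + t' * u = (1 / \<gamma> - 1) * x $ k"
    proof -
      \<comment> \<open>In the sum to be simplified the two terms with \<open>t\<close> cancel,
        which makes the map triangular; this identity gives the remaining coefficient of
        \<open>x $ k\<close>.\<close>
      have "\<gamma> - \<gamma> * u\<^sup>2 / c\<^sup>2 = 1 / \<gamma>"
        using \<gamma> u by (simp add: field_simps power2_eq_square)
      moreover have "(\<gamma> - 1) * x $ k - \<gamma> * t * u + t' * u = (\<gamma> - \<gamma> * u\<^sup>2 / c\<^sup>2 - 1) * x $ k"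
        by (simp add: t'_def power2_eq_square algebra_simps)
      ultimately show ?thesis
        by simp
    qed
    finally show ?thesis
      by (simp add: t'_def)
  qed
  have basis: "axis None 1 = event 1 (0 :: real ^ 'd)" "axis (Some l) 1 = event 0 (axis l 1)"
    for l :: 'd
    by (simp_all add: vec_eq_iff split_option_all event_def axis_def)
  have "matrix (\<lambda>\<xi>. galilei (- (u *\<^sub>R axis k 1)) (lorentz c (u *\<^sub>R axis k 1) \<xi>)) =
      inverse_axis_step c \<gamma> u k"
    unfolding vec_eq_iff split_option_all matrix_def vec_lambda_beta basis triangular
    by (auto simp: inverse_axis_step_def event_def axis_def)
  then show ?thesis
    using matrix_inv_canonical_step[of "u *\<^sub>R axis k 1 :: real ^ 'd" c] u n by simp
qed

lemma sum_UNIV_option: "(\<Sum>i\<in>UNIV. f i) = f None + (\<Sum>k\<in>UNIV. f (Some k))"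
  for f :: "'d::finite option \<Rightarrow> 'a::comm_monoid_add"
  by (simp add: UNIV_option_conv sum.reindex)

lemma endpoint_cometric_canonical_step_axis:
  fixes k :: 2
  assumes u: "0 < u" "u < c"
  shows "endpoint_cometric c (canonical_step c (u *\<^sub>R axis k 1)) = Q_c c (u *\<^sub>R axis k 1)"
proof -
  define \<gamma> where "\<gamma> = lorentz_factor c (u *\<^sub>R axis k 1 :: real ^ 2)"
  have \<gamma>: "\<gamma> > 0" "\<gamma>\<^sup>2 * (c\<^sup>2 - u\<^sup>2) = c\<^sup>2"
    using lorentz_factor_pos[of "u *\<^sub>R axis k 1 :: real ^ 2" c]
      lorentz_factor_square[of "u *\<^sub>R axis k 1 :: real ^ 2" c] u
    by (simp_all add: \<gamma>_def)
  \<comment> \<open>These settle the time-time entry and, up to sign, the diagonal entry at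
    \<open>k\<close>. In the mixed entry \<gamma> cancels and leaves \<open>u\<close>.\<close>
  have "\<gamma> * \<gamma> - \<gamma> * u * (\<gamma> * u) / c\<^sup>2 = 1" "c\<^sup>2 / (\<gamma> * \<gamma>) = c\<^sup>2 - u\<^sup>2"
    using \<gamma> u by (simp_all add: field_simps power2_eq_square)
  then show ?thesis
    unfolding endpoint_cometric_def matrix_inv_canonical_step_axis[OF u] \<gamma>_def[symmetric]
    using exhaust_2[of k] \<gamma> u
    by (auto simp: inverse_axis_step_def Q_star_def Q_c_def block_def outer_def
        vec_eq_iff matrix_matrix_mult_def transpose_def mat_def axis_def sum_UNIV_option UNIV_2
        split_option_all forall_2 power2_eq_square field_simps)
qed

section \<open>Comparing cometrics up to a positive factor\<close>

lemma same_cometric_Q_c_imp_isotropic: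
  assumes "same_cometric (block 1 v (outer v - C)) (Q_c c v')"
  shows "C = c\<^sup>2 *\<^sub>R mat 1"
proof -
  obtain k where k: "block 1 v (outer v - C) = k *\<^sub>R Q_c c v'"
    using assms by (auto simp: same_cometric_def)
  have ent: "block 1 v (outer v - C) $ i $ j = (k *\<^sub>R Q_c c v') $ i $ j" for i j
    by (simp add: k)
  \<comment> \<open>Both time-time entries are 1, which fixes the scale; the mixed entries then fix
    the velocity, and only the tensors remain to be compared.\<close>
  have "k = 1"
    using ent[of None None] by (simp add: block_def Q_c_def)
  have "v = v'"
    using ent[of None "Some _"] \<open>k = 1\<close> by (simp add: block_def Q_c_def vec_eq_iff)
  have "outer v - C = outer v - c\<^sup>2 *\<^sub>R mat 1"
    using ent[of "Some _" "Some _"] unfolding \<open>k = 1\<close> \<open>v = v'\<close>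
    by (simp add: block_def Q_c_def vec_eq_iff)
  then show ?thesis
    by simp
qed

lemma same_cometric_scaleR:
  assumes "k > 0"
  shows "same_cometric (k *\<^sub>R P) Q \<longleftrightarrow> same_cometric P Q"
proof
  assume "same_cometric (k *\<^sub>R P) Q"
  then obtain l where "l > 0" "k *\<^sub>R P = l *\<^sub>R Q"
    by (auto simp: same_cometric_def)
  then have "P = (l / k) *\<^sub>R Q"
    using assms by (metis divide_inverse_commute less_irrefl scaleR_scaleR scaleR_one
        left_inverse)
  then show "same_cometric P Q"
    unfolding same_cometric_def using assms \<open>l > 0\<close> by (intro exI[of _ "l / k"]) simp
next
  assume "same_cometric P Q"
  then obtain l where "l > 0" "P = l *\<^sub>R Q"
    by (auto simp: same_cometric_def)
  then show "same_cometric (k *\<^sub>R P) Q"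
    unfolding same_cometric_def using assms by (intro exI[of _ "k * l"]) simp
qed

lemma same_cometric_refl: "same_cometric Q Q"
  by (auto simp: same_cometric_def intro: exI[of _ 1])

section \<open>Endpoint cometrics of two axis steps\<close>

lemma endpoint_cometric_two_axis_steps:
  fixes k l :: 2
  assumes "0 < u" "u < c" "0 < v" "v < c"
  shows "endpoint_cometric c (canonical_step c (v *\<^sub>R axis l 1) ** canonical_step c (u *\<^sub>R axis k 1)) =
    matrix_inv (canonical_step c (u *\<^sub>R axis k 1)) ** Q_c c (v *\<^sub>R axis l 1) **
    transpose (matrix_inv (canonical_step c (u *\<^sub>R axis k 1)))"
  using assms
  by (simp add: endpoint_cometric_mult invertible_canonical_step
      endpoint_cometric_canonical_step_axis)

text \<open>The second step does not couple the first axis to anything, so time and first axis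
  behave as after a single step. The mixed entry \<open>v\<close> of the second axis picks up
  \<gamma> from the time row.\<close>

lemma endpoint_cometric_perpendicular:
  fixes u v c :: real
  assumes "0 < u" "u < c" "0 < v" "v < c"
  defines "\<gamma> \<equiv> lorentz_factor c (u *\<^sub>R axis 1 1 :: real ^ 2)"
  shows "endpoint_cometric c
      (canonical_step c (v *\<^sub>R axis 2 1 :: real ^ 2) ** canonical_step c (u *\<^sub>R axis 1 1)) =
    block 1 (vector [u, \<gamma> * v]) (vector [vector [u\<^sup>2 - c\<^sup>2, 0], vector [0, v\<^sup>2 - c\<^sup>2]])"
proof -
  have \<gamma>: "\<gamma> > 0" "\<gamma>\<^sup>2 * (c\<^sup>2 - u\<^sup>2) = c\<^sup>2"
    using lorentz_factor_pos[of "u *\<^sub>R axis 1 1 :: real ^ 2" c]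
      lorentz_factor_square[of "u *\<^sub>R axis 1 1 :: real ^ 2" c] assms
    by simp_all
  show ?thesis
    unfolding endpoint_cometric_two_axis_steps[OF assms(1-4)]
      matrix_inv_canonical_step_axis[OF assms(1,2)] \<gamma>_def[symmetric]
    using \<gamma> assms(1-4)
    by (simp add: inverse_axis_step_def Q_c_def block_def outer_def
        vec_eq_iff matrix_matrix_mult_def transpose_def mat_def axis_def sum_UNIV_option UNIV_2
        split_option_all forall_2 power2_eq_square field_simps)
qed

text \<open>The congruence mixes only time and the first axis, so the second axis keeps
  \<open>- c\<^sup>2\<close>. The time-time entry is left unreduced until it is compared with
  1.\<close>

lemma endpoint_cometric_collinear:
  fixes u v c :: real
  assumes "0 < u" "u < c" "0 < v" "v < c"
  defines "\<gamma> \<equiv> lorentz_factor c (u *\<^sub>R axis 1 1 :: real ^ 2)"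
  shows "endpoint_cometric c
      (canonical_step c (v *\<^sub>R axis 1 1 :: real ^ 2) ** canonical_step c (u *\<^sub>R axis 1 1)) =
    block (\<gamma>\<^sup>2 * (1 - 2 * u * v / c\<^sup>2 + u\<^sup>2 * (v\<^sup>2 - c\<^sup>2) / c ^ 4))
      (vector [v - u * (v\<^sup>2 - c\<^sup>2) / c\<^sup>2, 0])
      (vector [vector [(v\<^sup>2 - c\<^sup>2) / \<gamma>\<^sup>2, 0], vector [0, - c\<^sup>2]])"
proof -
  have \<gamma>: "\<gamma> > 0"
    using lorentz_factor_pos[of "u *\<^sub>R axis 1 1 :: real ^ 2" c] assms by simp_all
  show ?thesis
    unfolding endpoint_cometric_two_axis_steps[OF assms(1-4)]
      matrix_inv_canonical_step_axis[OF assms(1,2)] \<gamma>_def[symmetric]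
    using \<gamma> assms(1-4)
    by (simp add: inverse_axis_step_def Q_c_def block_def outer_def
        vec_eq_iff matrix_matrix_mult_def transpose_def mat_def axis_def sum_UNIV_option UNIV_2
        split_option_all forall_2 power2_eq_square power4_eq_xxxx field_simps)
qed

theorem theorem13:
  fixes c u\<^sub>1 u\<^sub>2 :: real
  assumes "0 < c" and "0 < u\<^sub>1" "u\<^sub>1 < c" and "0 < u\<^sub>2" "u\<^sub>2 < c"
  shows
    "(let e\<^sub>1 = (axis 1 1 :: real ^ 2);
          e\<^sub>2 = (axis 2 1 :: real ^ 2);
          W = canonical_step c (u\<^sub>2 *\<^sub>R e\<^sub>2) ** canonical_step c (u\<^sub>1 *\<^sub>R e\<^sub>1);
          Q\<^sub>e = endpoint_cometric c W;
          \<gamma>\<^sub>1 = 1 / sqrt (1 - u\<^sub>1\<^sup>2 / c\<^sup>2);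
          chi = \<gamma>\<^sub>1 * u\<^sub>1 * u\<^sub>2;
          v\<^sub>3 = (vector [u\<^sub>1, \<gamma>\<^sub>1 * u\<^sub>2] :: real ^ 2);
          C\<^sub>3 = (vector [vector [c\<^sup>2, chi], vector [chi, c\<^sup>2 + chi\<^sup>2 / c\<^sup>2]] :: real ^ 2 ^ 2);
          A\<^sub>3 = C\<^sub>3 - outer v\<^sub>3
      in Q\<^sub>e $ None $ None = 1
        \<and> Q\<^sub>e = block 1 v\<^sub>3 (outer v\<^sub>3 - C\<^sub>3)
        \<and> det C\<^sub>3 = c ^ 4
        \<and> A\<^sub>3 = vector [vector [c\<^sup>2 - u\<^sub>1\<^sup>2, 0], vector [0, c\<^sup>2 - u\<^sub>2\<^sup>2]]
        \<and> positive_definite A\<^sub>3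
        \<and> C\<^sub>3 \<noteq> c\<^sup>2 *\<^sub>R mat 1
        \<and> (\<forall>v. Q\<^sub>e \<noteq> Q_c c v)
        \<and> (\<forall>v. \<not> same_cometric Q\<^sub>e (Q_c c v)))
     \<and> \<not> closed_under_canonical_transport c (range (Q_c c :: real ^ 2 \<Rightarrow> _))
     \<and> (let e\<^sub>1 = (axis 1 1 :: real ^ 2);
            W = canonical_step c (u\<^sub>2 *\<^sub>R e\<^sub>1) ** canonical_step c (u\<^sub>1 *\<^sub>R e\<^sub>1);
            Q\<^sub>e = endpoint_cometric c W;
            q = Q\<^sub>e $ None $ None
        in q \<noteq> 1
          \<and> (q > 0 \<longrightarrow>
              (\<exists>v C. (1 / q) *\<^sub>R Q\<^sub>e = block 1 v (outer v - C) \<and> (\<forall>k. C \<noteq> k *\<^sub>R mat 1))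
              \<and> (\<forall>v'. (1 / q) *\<^sub>R Q\<^sub>e \<noteq> Q_c c v'))
          \<and> (\<forall>v. \<not> same_cometric Q\<^sub>e (Q_c c v)))"
proof -
  define \<gamma> where "\<gamma> = lorentz_factor c (u\<^sub>1 *\<^sub>R axis 1 1 :: real ^ 2)"
  have \<gamma>_eq: "1 / sqrt (1 - u\<^sub>1\<^sup>2 / c\<^sup>2) = \<gamma>"
    using assms by (simp add: \<gamma>_def lorentz_factor_def)
  have \<gamma>: "\<gamma> > 0" "\<gamma>\<^sup>2 * (c\<^sup>2 - u\<^sub>1\<^sup>2) = c\<^sup>2"
    using lorentz_factor_pos[of "u\<^sub>1 *\<^sub>R axis 1 1 :: real ^ 2" c]
      lorentz_factor_square[of "u\<^sub>1 *\<^sub>R axis 1 1 :: real ^ 2" c] assms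
    by (simp_all add: \<gamma>_def)
  have less: "u\<^sub>1\<^sup>2 < c\<^sup>2" "u\<^sub>2\<^sup>2 < c\<^sup>2"
    using assms by (simp_all add: power_strict_mono)

  \<comment> \<open>Perpendicular steps\<close>
  define chi where "chi = \<gamma> * u\<^sub>1 * u\<^sub>2"
  define v\<^sub>3 where "v\<^sub>3 = (vector [u\<^sub>1, \<gamma> * u\<^sub>2] :: real ^ 2)"
  define C\<^sub>3 where
    "C\<^sub>3 = (vector [vector [c\<^sup>2, chi], vector [chi, c\<^sup>2 + chi\<^sup>2 / c\<^sup>2]] :: real ^ 2 ^ 2)"
  define Q where "Q = endpoint_cometric c
    (canonical_step c (u\<^sub>2 *\<^sub>R axis 2 1 :: real ^ 2) ** canonical_step c (u\<^sub>1 *\<^sub>R axis 1 1))"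
  have A\<^sub>3: "C\<^sub>3 - outer v\<^sub>3 = vector [vector [c\<^sup>2 - u\<^sub>1\<^sup>2, 0], vector [0, c\<^sup>2 - u\<^sub>2\<^sup>2]]"
  proof -
    have "chi\<^sup>2 / c\<^sup>2 = (\<gamma> * u\<^sub>2)\<^sup>2 - u\<^sub>2\<^sup>2"
    proof -
      \<comment> \<open>Here \<open>u\<^sub>1\<^sup>2\<close> is written as
        \<open>c\<^sup>2 - (c\<^sup>2 - u\<^sub>1\<^sup>2)\<close>, so that the relation for
        \<gamma> applies to the second summand.\<close>
      have "chi\<^sup>2 = (\<gamma>\<^sup>2 * c\<^sup>2 - \<gamma>\<^sup>2 * (c\<^sup>2 - u\<^sub>1\<^sup>2)) * u\<^sub>2\<^sup>2"
        by (simp add: chi_def power_mult_distrib algebra_simps)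
      then show ?thesis
        using \<open>0 < c\<close> by (simp add: \<gamma>(2) field_simps)
    qed
    then show ?thesis
      by (simp add: vec_eq_iff forall_2 C\<^sub>3_def v\<^sub>3_def outer_def chi_def power2_eq_square
          algebra_simps)
  qed
  have Q: "Q = block 1 v\<^sub>3 (outer v\<^sub>3 - C\<^sub>3)"
  proof -
    have "outer v\<^sub>3 - C\<^sub>3 = - (C\<^sub>3 - outer v\<^sub>3)"
      by simp
    also have "\<dots> = vector [vector [u\<^sub>1\<^sup>2 - c\<^sup>2, 0], vector [0, u\<^sub>2\<^sup>2 - c\<^sup>2]]"
      unfolding A\<^sub>3 by (simp add: vec_eq_iff forall_2)
    finally show ?thesis
      using assms by (simp add: Q_def endpoint_cometric_perpendicular \<gamma>_def v\<^sub>3_def)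
  qed
  have Q00: "Q $ None $ None = 1"
    by (simp add: Q block_def)
  have det: "det C\<^sub>3 = c ^ 4"
    using \<open>0 < c\<close> by (simp add: det_2 C\<^sub>3_def field_simps power2_eq_square power4_eq_xxxx)
  have pd: "positive_definite (C\<^sub>3 - outer v\<^sub>3)"
    unfolding positive_definite_def
  proof (intro conjI allI impI)
    show "transpose (C\<^sub>3 - outer v\<^sub>3) = C\<^sub>3 - outer v\<^sub>3"
      unfolding A\<^sub>3 by (simp add: transpose_def vec_eq_iff forall_2)
    fix x :: "real ^ 2"
    assume "x \<noteq> 0"
    then have "x $ 1 \<noteq> 0 \<or> x $ 2 \<noteq> 0"
      by (simp add: vec_eq_iff forall_2)
    moreover have "x \<bullet> ((C\<^sub>3 - outer v\<^sub>3) *v x)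
        = (c\<^sup>2 - u\<^sub>1\<^sup>2) * (x $ 1)\<^sup>2 + (c\<^sup>2 - u\<^sub>2\<^sup>2) * (x $ 2)\<^sup>2"
      unfolding A\<^sub>3
      by (simp add: inner_vec_def matrix_vector_mult_def sum_2 power2_eq_square algebra_simps)
    ultimately show "x \<bullet> ((C\<^sub>3 - outer v\<^sub>3) *v x) > 0"
      using less by (auto intro: add_pos_nonneg add_nonneg_pos)
  qed
  have aniso: "C\<^sub>3 \<noteq> c\<^sup>2 *\<^sub>R mat 1"
  proof -
    \<comment> \<open>The off-diagonal entry \<open>chi\<close> is a product of three positive
      factors, while a multiple of the identity vanishes there.\<close>
    have "C\<^sub>3 $ 1 $ 2 > 0"
      using \<gamma> assms by (simp add: C\<^sub>3_def chi_def)
    then show ?thesis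
      by (auto simp: mat_def)
  qed
  have not_same: "\<not> same_cometric Q (Q_c c v)" for v
    using same_cometric_Q_c_imp_isotropic aniso unfolding Q by blast
  have not_eq: "Q \<noteq> Q_c c v" for v
    using not_same[of v] same_cometric_refl by metis

  have not_closed: "\<not> closed_under_canonical_transport c (range (Q_c c :: real ^ 2 \<Rightarrow> _))"
  proof
    assume "closed_under_canonical_transport c (range (Q_c c :: real ^ 2 \<Rightarrow> _))"
    moreover have "\<forall>v\<in>set [u\<^sub>1 *\<^sub>R axis 1 1 :: real ^ 2, u\<^sub>2 *\<^sub>R axis 2 1]. norm v < c"
      using assms by simp
    \<comment> \<open>The list has the earliest increment first, so its transport is the product in
      \<open>Q\<close>.\<close>
    ultimately obtain v where "same_cometric (endpoint_cometric c
        (canonical_transport c [u\<^sub>1 *\<^sub>R axis 1 1, u\<^sub>2 *\<^sub>R axis 2 1])) (Q_c c (v :: real ^ 2))"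
      unfolding closed_under_canonical_transport_def by blast
    then show False
      using not_same[of v] by (simp add: canonical_transport_def Q_def)
  qed

  \<comment> \<open>Collinear steps\<close>
  define P where "P = endpoint_cometric c
    (canonical_step c (u\<^sub>2 *\<^sub>R axis 1 1 :: real ^ 2) ** canonical_step c (u\<^sub>1 *\<^sub>R axis 1 1))"
  define q where "q = P $ None $ None"
  define r s where "r = u\<^sub>2 - u\<^sub>1 * (u\<^sub>2\<^sup>2 - c\<^sup>2) / c\<^sup>2" and "s = (u\<^sub>2\<^sup>2 - c\<^sup>2) / \<gamma>\<^sup>2"
  have P0: "P = block (\<gamma>\<^sup>2 * (1 - 2 * u\<^sub>1 * u\<^sub>2 / c\<^sup>2 + u\<^sub>1\<^sup>2 * (u\<^sub>2\<^sup>2 - c\<^sup>2) / c ^ 4))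
      (vector [r, 0]) (vector [vector [s, 0], vector [0, - c\<^sup>2]])"
    unfolding P_def r_def s_def \<gamma>_def using assms(2-) by (rule endpoint_cometric_collinear)
  then have q: "q = \<gamma>\<^sup>2 * (1 - 2 * u\<^sub>1 * u\<^sub>2 / c\<^sup>2 + u\<^sub>1\<^sup>2 * (u\<^sub>2\<^sup>2 - c\<^sup>2) / c ^ 4)"
    by (simp add: q_def block_def)
  have P: "P = block q (vector [r, 0]) (vector [vector [s, 0], vector [0, - c\<^sup>2]])"
    using P0 q by simp
  \<comment> \<open>This is the determinant of the block of time and first axis: the congruence has
    determinant 1 there, and the block of \<open>Q_c\<close> has determinant
    \<open>- c\<^sup>2\<close>.\<close>
  have det_tx: "q * s = r\<^sup>2 - c\<^sup>2"
    using \<gamma>(1) \<open>0 < c\<close>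
    by (simp add: q r_def s_def field_simps power2_eq_square power4_eq_xxxx)
  have q_ne: "q \<noteq> 1"
  proof -
    have "0 < u\<^sub>1 * u\<^sub>2" "u\<^sub>1 * u\<^sub>2 < c\<^sup>2"
      using assms by (simp_all add: power2_eq_square mult_strict_mono)
    then have neg: "\<gamma>\<^sup>2 * (u\<^sub>1 * u\<^sub>2 * (u\<^sub>1 * u\<^sub>2 - 2 * c\<^sup>2)) < 0"
      using \<gamma> by (intro mult_pos_neg) auto
    \<comment> \<open>The first summand equals \<open>c ^ 4\<close> by the relation for \<gamma>, so
      the negative second summand is the whole deviation of \<open>q\<close> from 1.\<close>
    have "c ^ 4 * q = c\<^sup>2 * (\<gamma>\<^sup>2 * (c\<^sup>2 - u\<^sub>1\<^sup>2)) + \<gamma>\<^sup>2 * (u\<^sub>1 * u\<^sub>2 * (u\<^sub>1 * u\<^sub>2 - 2 * c\<^sup>2))"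
      using \<open>0 < c\<close> by (simp add: q field_simps power2_eq_square power4_eq_xxxx)
    also have "\<dots> < c ^ 4"
      using neg unfolding \<gamma>(2) by (simp flip: power_add)
    finally show ?thesis
      by auto
  qed
  \<comment> \<open>Division by \<open>q\<close> gives the velocity \<open>r / q\<close>. The first
    entry of \<open>C\<close> is \<open>(r\<^sup>2 - q * s) / q\<^sup>2\<close>, which
    \<open>det_tx\<close> turns into \<open>c\<^sup>2 / q\<^sup>2\<close>.\<close>
  define v where "v = (vector [r / q, 0] :: real ^ 2)"
  define C where "C = (vector [vector [c\<^sup>2 / q\<^sup>2, 0], vector [0, c\<^sup>2 / q]] :: real ^ 2 ^ 2)"
  have normalised: "(1 / q) *\<^sub>R P = block 1 v (outer v - C)" if "q > 0"
  proof -
    have "s / q = (r / q) * (r / q) - c\<^sup>2 / q\<^sup>2"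
      using det_tx that by (simp add: field_simps power2_eq_square)
    then show ?thesis
      using that unfolding P
      by (simp add: vec_eq_iff split_option_all forall_2 block_def outer_def v_def C_def)
  qed
  have C: "C \<noteq> k *\<^sub>R mat 1" if "q > 0" for k
  proof
    assume "C = k *\<^sub>R mat 1"
    \<comment> \<open>Equal diagonal entries would force \<open>q = 1\<close>.\<close>
    then have "C $ 1 $ 1 = C $ 2 $ 2"
      by (simp add: mat_def)
    then show False
      using that q_ne \<open>0 < c\<close> by (simp add: C_def field_simps power2_eq_square)
  qed
  have norm_not_same: "\<not> same_cometric ((1 / q) *\<^sub>R P) (Q_c c v')" if "q > 0" for v'
    using same_cometric_Q_c_imp_isotropic C[OF that] unfolding normalised[OF that] by blast
  have P_not_same: "\<not> same_cometric P (Q_c c v')" for v'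
  proof
    assume same: "same_cometric P (Q_c c v')"
    \<comment> \<open>A positive multiple of \<open>Q_c c v'\<close> has a positive time-time entry,
      so nonpositive \<open>q\<close> is excluded before normalising.\<close>
    then have "q > 0"
      by (auto simp: same_cometric_def q_def Q_c_def block_def)
    then show False
      using same norm_not_same[of v'] by (simp add: same_cometric_scaleR)
  qed
  have norm_not_eq: "(1 / q) *\<^sub>R P \<noteq> Q_c c v'" if "q > 0" for v'
    using norm_not_same[OF that, of v'] same_cometric_refl by metis
  have collinear: "q > 0 \<longrightarrow>
      (\<exists>v C. (1 / q) *\<^sub>R P = block 1 v (outer v - C) \<and> (\<forall>k. C \<noteq> k *\<^sub>R mat 1))
      \<and> (\<forall>v'. (1 / q) *\<^sub>R P \<noteq> Q_c c v')"
    using normalised C norm_not_eq by blast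

  show ?thesis
    unfolding Let_def \<gamma>_eq chi_def[symmetric] v\<^sub>3_def[symmetric] C\<^sub>3_def[symmetric]
      Q_def[symmetric] P_def[symmetric] q_def[symmetric]
    using Q00 Q det A\<^sub>3 pd aniso not_eq not_same not_closed q_ne collinear P_not_same by blast
qed

end
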